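(* Let $0<q<1$ and $x>0$. Let $a=f(t)\,d_qt$ and $b=g(t)\,d_qt$ be $q$-difference $1$-forms, and let $u=\omega_1\cdots\omega_m$ and $v=\omega_1'\cdots\omega_n'$ ($m,n\ge 0$) be words in $q$-difference $1$-forms, where all the functions defining these forms are Riemann integrable functions $[0,x]\to\mathbb{R}$. Then the iterated Jackson $q$-integrals satisfy $$\bigg(\int_0^x au\bigg)\bigg(\int_0^x bv\bigg)=\int_0^x f(s)\bigg(\int_0^s u\bigg)\bigg(\int_0^s bv\bigg)\,d_qs+\int_0^x g(s)\bigg(\int_0^{sq} au\bigg)\bigg(\int_0^s v\bigg)\,d_qs .$$
   Context: For $0<q<1$, $y>0$ and $h$ a real-valued function defined on $(0,y]$, the Jackson $q$-integral is $$\int_0^y h(t)\,d_qt:=\sum_{n\ge 0}h(yq^n)\,yq^n(1-q).$$ For functions $f_1,\dots,f_n:[0,x]\to\mathbb{R}$ and the $q$-difference $1$-forms $\omega_j=f_j(t)\,d_qt$, the iterated Jackson $q$-integral of the word $\omega_1\omega_2\cdots\omega_n$ is defined recursively, for $0<y\le x$, by $$\int_0^y\omega_1\omega_2\cdots\omega_n:=\begin{cases}\displaystyle\int_0^y f_1(t_1)\bigg(\int_0^{t_1}\omega_2\cdots\omega_n\bigg)\,d_qt_1 & \text{if } n>0,\\[2mm] 1 & \text{if } n=0\ (\text{the empty word}).\end{cases}$$ The notation $au$ means the word obtained by placing the letter $a$ in front of the word $u$; thus $\int_0^y au=\int_0^y f(t)\big(\int_0^t u\big)\,d_qt$, and similarly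 for $bv$. *)

theory Defs
  imports "HOL-Analysis.Analysis"
begin

definition upper_darboux_integral :: "real \<Rightarrow> real \<Rightarrow> (real \<Rightarrow> real) \<Rightarrow> real" where
  "upper_darboux_integral a b f =
     (INF D\<in>{D. D division_of {a..b}}. \<Sum>K\<in>D. measure lborel K * (SUP t\<in>K. f t))"

definition lower_darboux_integral :: "real \<Rightarrow> real \<Rightarrow> (real \<Rightarrow> real) \<Rightarrow> real" where
  "lower_darboux_integral a b f =
     (SUP D\<in>{D. D division_of {a..b}}. \<Sum>K\<in>D. measure lborel K * (INF t\<in>K. f t))"

text \<open>Proper Riemann integrability in Darboux's form; the library's \<open>integrable_on\<close>
  is Henstock-Kurzweil integrability, which also admits unbounded functions.\<close>

definition riemann_integrable :: "real \<Rightarrow> real \<Rightarrow> (real \<Rightarrow> real) \<Rightarrow> bool" where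
  "riemann_integrable a b f \<longleftrightarrow>
     bounded (f ` {a..b}) \<and> upper_darboux_integral a b f = lower_darboux_integral a b f"

definition jackson_integral :: "real \<Rightarrow> real \<Rightarrow> (real \<Rightarrow> real) \<Rightarrow> real" where
  "jackson_integral q y h = (\<Sum>n. h (y * q ^ n) * (y * q ^ n) * (1 - q))"

text \<open>The form \<open>f(t) d\<^sub>qt\<close> is represented by its coefficient function \<open>f\<close>, and a word
  by the list of the coefficient functions of its letters, so \<open>au\<close> is \<open>f # u\<close>.\<close>

primrec iterated_jackson :: "real \<Rightarrow> (real \<Rightarrow> real) list \<Rightarrow> real \<Rightarrow> real" where
  "iterated_jackson q [] y = 1"
| "iterated_jackson q (f # w) y = jackson_integral q y (\<lambda>t. f t * iterated_jackson q w t)"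

end

theory Submission
  imports Defs
begin

text \<open>
  On the grid \<open>x q\<^sup>n\<close> the product \<open>(\<integral> au)(\<integral> bv)\<close> tends to \<open>0\<close>, and
  since \<open>\<integral>\<^sub>0\<^sup>y h d\<^sub>qt - \<integral>\<^sub>0\<^sup>y\<^sup>q h d\<^sub>qt = h(y) y (1 - q)\<close>, the discrete
  product rule \<open>A B - A' B' = (A - A') B + A' (B - B')\<close> makes it the telescoping sum of the
  terms of the two integrals on the right. Bounded integrands make all the series converge
  absolutely.
\<close>

text \<open>The weights \<open>y * q ^ n * (1 - q)\<close> form a geometric series with sum
  \<open>y\<close>, so comparison with \<open>M\<close> times it gives both claims. A bound linear
  in \<open>y\<close> makes the integrals vanish in the limit along the grid.\<close>

lemma jackson_integral_bound:
  fixes q x y M :: real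
  assumes q: "0 < q" "q < 1" and y: "0 \<le> y" "y \<le> x"
    and h: "\<forall>t\<in>{0..x}. \<bar>h t\<bar> \<le> M"
  shows "summable (\<lambda>n. \<bar>h (y * q ^ n) * (y * q ^ n) * (1 - q)\<bar>)"
    and "\<bar>jackson_integral q y h\<bar> \<le> M * y"
proof -
  have term_le: "\<bar>h (y * q ^ n) * (y * q ^ n) * (1 - q)\<bar> \<le> M * y * (1 - q) * q ^ n" for n
  proof -
    have "y * q ^ n \<le> y * 1"
      using q y by (intro mult_left_mono power_le_one) auto
    then have "\<bar>h (y * q ^ n)\<bar> * (y * q ^ n * (1 - q)) \<le> M * (y * q ^ n * (1 - q))"
      using q y by (intro mult_right_mono h[rule_format]) auto
    then show ?thesis
      using q y by (simp add: abs_mult mult_ac)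
  qed
  have "(\<lambda>n. M * y * (1 - q) * q ^ n) sums (M * y * (1 - q) * (1 / (1 - q)))"
    using q by (intro sums_mult geometric_sums) simp
  then have sums: "(\<lambda>n. M * y * (1 - q) * q ^ n) sums (M * y)"
    using q by simp
  show summable: "summable (\<lambda>n. \<bar>h (y * q ^ n) * (y * q ^ n) * (1 - q)\<bar>)"
    by (rule summable_comparison_test'[OF sums_summable[OF sums]]) (use term_le in simp)
  have "\<bar>jackson_integral q y h\<bar> \<le> (\<Sum>n. \<bar>h (y * q ^ n) * (y * q ^ n) * (1 - q)\<bar>)"
    unfolding jackson_integral_def by (rule summable_rabs[OF summable])
  also have "\<dots> \<le> M * y"
    using suminf_le[OF term_le summable sums_summable[OF sums]] sums_unique[OF sums] by simp
  finally show "\<bar>jackson_integral q y h\<bar> \<le> M * y" .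
qed

lemma jackson_integral_step:
  assumes "summable (\<lambda>n. h (y * q ^ n) * (y * q ^ n) * (1 - q))"
  shows "jackson_integral q y h = h y * y * (1 - q) + jackson_integral q (y * q) h"
  using suminf_split_head[OF assms] by (simp add: jackson_integral_def mult_ac)

text \<open>Boundedness passes from \<open>w\<close> to \<open>h # w\<close>: the new integrand is a
  product of bounded functions, and the linear bound \<open>L * M * y\<close> is at most
  \<open>L * M * x\<close>. This makes the integrands of the outer integrals bounded.\<close>

lemma iterated_jackson_bounded:
  assumes q: "0 < q" "q < 1" and x: "0 \<le> x"
    and w: "\<forall>h\<in>set w. bounded (h ` {0..x})"
  shows "bounded (iterated_jackson q w ` {0..x})"
  using w
proof (induction w)
  case Nil
  then show ?case by (auto simp: bounded_iff)
next
  case (Cons h w)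
  obtain L where L: "\<forall>t\<in>{0..x}. \<bar>h t\<bar> \<le> L"
    using Cons.prems by (auto simp: bounded_iff)
  obtain M where M: "\<forall>t\<in>{0..x}. \<bar>iterated_jackson q w t\<bar> \<le> M"
    using Cons by (auto simp: bounded_iff)
  \<comment> \<open>Since \<open>0\<close> lies in the interval, an absolute value there is at most
    \<open>L\<close>; \<open>mult_mono\<close> needs this sign.\<close>
  have "L \<ge> 0"
    using bspec[OF L, of 0] x by simp
  then have LM: "\<forall>t\<in>{0..x}. \<bar>h t * iterated_jackson q w t\<bar> \<le> L * M"
    using L M by (auto simp: abs_mult intro!: mult_mono)
  have "L * M \<ge> 0"
    using bspec[OF LM, of 0] x by simp
  have "\<bar>iterated_jackson q (h # w) y\<bar> \<le> L * M * x" if "y \<in> {0..x}" for y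
  proof -
    have "\<bar>iterated_jackson q (h # w) y\<bar> \<le> L * M * y"
      unfolding iterated_jackson.simps
      by (rule jackson_integral_bound(2)[OF q _ _ LM]) (use that in auto)
    also have "\<dots> \<le> L * M * x"
      using that \<open>L * M \<ge> 0\<close> by (intro mult_left_mono) auto
    finally show ?thesis .
  qed
  then show ?case
    by (force simp: bounded_iff simp del: iterated_jackson.simps)
qed

lemma bounded_image_mult:
  fixes f g :: "'a \<Rightarrow> real"
  assumes "bounded (f ` S)" "bounded (g ` S)"
  shows "bounded ((\<lambda>t. f t * g t) ` S)"
proof -
  obtain L M where "\<forall>t\<in>S. \<bar>f t\<bar> \<le> L" "\<forall>t\<in>S. \<bar>g t\<bar> \<le> M"
    using assms by (auto simp: bounded_iff)
  then have "\<forall>t\<in>S. \<bar>f t * g t\<bar> \<le> L * M"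
    by (auto simp: abs_mult intro!: mult_mono intro: order_trans[OF abs_ge_zero])
  then show ?thesis
    by (auto simp: bounded_iff)
qed

text \<open>This is the theorem with each word integrand collapsed into one bounded function. The
  shift \<open>s * q\<close> falls on one factor because the discrete product rule takes one factor
  at the old grid point and the other at the next.\<close>

lemma jackson_integral_mult:
  fixes q x :: real
  assumes q: "0 < q" "q < 1" and x: "0 \<le> x"
    and h: "bounded (h ` {0..x})" and k: "bounded (k ` {0..x})"
  shows "jackson_integral q x h * jackson_integral q x k =
    jackson_integral q x (\<lambda>s. h s * jackson_integral q s k) +
    jackson_integral q x (\<lambda>s. k s * jackson_integral q (s * q) h)"
proof -
  obtain H where H: "\<forall>t\<in>{0..x}. \<bar>h t\<bar> \<le> H"
    using h by (auto simp: bounded_iff)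
  obtain K where K: "\<forall>t\<in>{0..x}. \<bar>k t\<bar> \<le> K"
    using k by (auto simp: bounded_iff)
  have HK: "H \<ge> 0" "K \<ge> 0"
    using bspec[OF H, of 0] bspec[OF K, of 0] x by simp_all
  \<comment> \<open>\<open>A\<close> and \<open>B\<close> are the integrals up to the grid points;
    \<open>F\<close> and \<open>G\<close> will be their successive differences.\<close>
  define A B where "A n = jackson_integral q (x * q ^ n) h"
    and "B n = jackson_integral q (x * q ^ n) k" for n
  define F G where "F n = h (x * q ^ n) * (x * q ^ n) * (1 - q)"
    and "G n = k (x * q ^ n) * (x * q ^ n) * (1 - q)" for n
  have grid: "0 \<le> x * q ^ n" "x * q ^ n \<le> x" for n
    using q x mult_left_mono[OF power_le_one[of q n] x] by auto
  have A_le: "\<bar>A n\<bar> \<le> H * (x * q ^ n)" and B_le: "\<bar>B n\<bar> \<le> K * (x * q ^ n)" for n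
    unfolding A_def B_def
    by (rule jackson_integral_bound(2)[OF q grid H])
       (rule jackson_integral_bound(2)[OF q grid K])
  \<comment> \<open>These bounds, uniform in \<open>n\<close>, give summability of the products
    below; the decaying bounds \<open>A_le\<close> and \<open>B_le\<close> give the limits.\<close>
  have A_bdd: "\<bar>A n\<bar> \<le> H * x" and B_bdd: "\<bar>B n\<bar> \<le> K * x" for n
    using A_le[of n] B_le[of n] mult_left_mono[OF grid(2)[of n] HK(1)]
      mult_left_mono[OF grid(2)[of n] HK(2)] by linarith+
  have A_step: "A n = F n + A (Suc n)" for n
    using jackson_integral_step[OF summable_rabs_cancel[OF
          jackson_integral_bound(1)[OF q grid[of n] H]]]
    by (simp add: A_def F_def mult_ac)
  have B_step: "B n = G n + B (Suc n)" for n
    using jackson_integral_step[OF summable_rabs_cancel[OF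
          jackson_integral_bound(1)[OF q grid[of n] K]]]
    by (simp add: B_def G_def mult_ac)
  have F: "summable (\<lambda>n. \<bar>F n\<bar>)" and G: "summable (\<lambda>n. \<bar>G n\<bar>)"
    unfolding F_def G_def
    by (rule jackson_integral_bound(1)[OF q x order_refl H])
       (rule jackson_integral_bound(1)[OF q x order_refl K])
  have FB: "summable (\<lambda>n. F n * B n)"
    by (rule summable_comparison_test'[OF summable_mult2[OF F, of "K * x"]])
       (use B_bdd in \<open>auto simp: abs_mult intro!: mult_left_mono\<close>)
  have GA: "summable (\<lambda>n. G n * A (Suc n))"
    by (rule summable_comparison_test'[OF summable_mult2[OF G, of "H * x"]])
       (use A_bdd in \<open>auto simp: abs_mult intro!: mult_left_mono\<close>)
  have q_lim: "(\<lambda>n. C * (x * q ^ n)) \<longlonglongrightarrow> 0" for C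
    using q by (intro tendsto_mult_right_zero LIMSEQ_power_zero) auto
  have "A \<longlonglongrightarrow> 0"
    by (rule Lim_null_comparison[OF _ q_lim[of H]]) (use A_le in simp)
  moreover have "B \<longlonglongrightarrow> 0"
    by (rule Lim_null_comparison[OF _ q_lim[of K]]) (use B_le in simp)
  ultimately have "(\<lambda>n. A n * B n) \<longlonglongrightarrow> 0"
    using tendsto_mult by fastforce
  then have "(\<lambda>n. A n * B n - A (Suc n) * B (Suc n)) sums (A 0 * B 0)"
    using telescope_sums' by fastforce
  \<comment> \<open>The discrete product rule: \<open>A\<close> changes against the old
    \<open>B\<close>, then \<open>B\<close> changes against the new \<open>A\<close>.\<close>
  moreover have "A n * B n - A (Suc n) * B (Suc n) = F n * B n + G n * A (Suc n)" for n
    using A_step[of n] B_step[of n] by (simp add: algebra_simps)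
  ultimately have "A 0 * B 0 = (\<Sum>n. F n * B n + G n * A (Suc n))"
    by (simp add: sums_iff)
  also have "\<dots> = (\<Sum>n. F n * B n) + (\<Sum>n. G n * A (Suc n))"
    by (rule suminf_add[OF FB GA, symmetric])
  finally show ?thesis
    \<comment> \<open>With \<open>s = x * q ^ n\<close>, the upper limit in \<open>A (Suc n)\<close>
      is \<open>s * q\<close>. Only the outer integrals are unfolded into series.\<close>
    by (simp add: A_def B_def F_def G_def jackson_integral_def[of q x "\<lambda>s. _ s * _ s"] mult_ac)
qed

theorem mainTheorem2:
  fixes q x :: real
    and f g :: "real \<Rightarrow> real"
    and u v :: "(real \<Rightarrow> real) list"
  assumes "0 < q" and "q < 1" and "0 < x"
    and "riemann_integrable 0 x f" and "riemann_integrable 0 x g"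
    and "\<forall>h\<in>set u. riemann_integrable 0 x h"
    and "\<forall>h\<in>set v. riemann_integrable 0 x h"
  shows "iterated_jackson q (f # u) x * iterated_jackson q (g # v) x =
    jackson_integral q x
      (\<lambda>s. f s * iterated_jackson q u s * iterated_jackson q (g # v) s) +
    jackson_integral q x
      (\<lambda>s. g s * iterated_jackson q (f # u) (s * q) * iterated_jackson q v s)"
proof -
  \<comment> \<open>Boundedness of the coefficients is part of \<open>riemann_integrable\<close>; it
    carries over to the iterated integrals and to these products.\<close>
  have "bounded ((\<lambda>t. f t * iterated_jackson q u t) ` {0..x})"
    "bounded ((\<lambda>t. g t * iterated_jackson q v t) ` {0..x})"
    using assms
    by (auto simp: riemann_integrable_def intro!: bounded_image_mult iterated_jackson_bounded)
  from jackson_integral_mult[OF assms(1,2) less_imp_le[OF assms(3)] this]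
  show ?thesis
    by (simp add: mult_ac)
qed

end
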